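(* (i) For $p\in[1,2]$ the function $f:(0,\infty)\to(0,\infty)$ defined by $f(x)=\operatorname{arctanh}_p\left(\frac{1}{\cosh(x)}\right)$ is strictly decreasing and convex. Consequently, for all $x,y\in(0,1)$ and $p\in[1,2]$, $$\operatorname{arctanh}_p(x)+\operatorname{arctanh}_p(y)> 2\operatorname{arctanh}_p\left(\sqrt{\frac{2xy}{1+xy+x'y'}}\right),$$ where $z'=\sqrt{1-z^2}$ for $z\in(0,1)$. (ii) For $p>0$ the function $g:(1,\infty)\to(0,\infty)$ defined by $g(x)=\operatorname{arctanh}_p\left(\frac{1}{x}\right)$ is strictly decreasing and convex. Consequently, for all $x,y\in(0,1)$ and $p>0$, $$\operatorname{arctanh}_p(x)+\operatorname{arctanh}_p(y)> 2\operatorname{arctanh}_p\left(\frac{2xy}{x+y}\right).$$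
   Context: For real $p>0$ and $x\in(0,1)$, define $\operatorname{arctanh}_p(x)=\int_0^x(1-t^p)^{-1}\,dt$.
   Formalization: Both inequalities are stated with ≥ for all x, y in (0,1) and with strict > only when x ≠ y, because for x = y the two sides are equal and the strict inequality fails. *)

theory Defs
  imports "HOL-Analysis.Analysis"
begin

(* Meant for p > 0 and 0 < x < 1, where the integrand is continuous on [0, x]. *)
definition arctanh_p :: "real \<Rightarrow> real \<Rightarrow> real" where
  "arctanh_p p x = integral {0..x} (\<lambda>t. inverse (1 - t powr p))"

end

theory Submission
  imports Defs
begin

text \<open>
  Both parts have the same shape. The function in question has a derivative \<open>-h\<close> on a ray
  \<open>(c, \<infinity>)\<close>, where \<open>h\<close> is positive and strictly decreasing; hence it is strictly decreasing and
  strictly convex, and strict convexity at a midpoint is the stated inequality after a change of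
  variables (\<open>strictly_convex_decreasing_on_ray\<close>).

  By the fundamental theorem of calculus, the derivative of \<open>arctanh\<^sub>p\<close> at \<open>u\<close> is
  \<open>1 / (1 - u\<^sup>p)\<close>.  For \<open>g\<close>, with \<open>u = 1/x\<close>, this gives \<open>h = (1/x\<^sup>2) / (1 - u\<^sup>p)\<close>, a product of two
  positive factors that both decrease in \<open>x\<close>.  For \<open>f\<close>, with \<open>u = 1/cosh x\<close>, the naive
  factorization does not work: \<open>sinh x / cosh\<^sup>2 x\<close> is not monotone.  But
  \<open>sinh x / cosh\<^sup>2 x = (1 - u\<^sup>2) / sinh x\<close>, so that
  \<open>h = (1 / sinh x) * ((1 - u\<^sup>2) / (1 - u\<^sup>p))\<close>, and for \<open>p \<le> 2\<close> the second factor is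
  nondecreasing in \<open>u\<close>: with \<open>s = u\<^sup>p\<close> and \<open>q = 2/p \<ge> 1\<close> it is the slope
  \<open>(1 - s\<^sup>q) / (1 - s)\<close> of a chord of a convex function (\<open>one_minus_square_over_powr_mono\<close>).

  The midpoints correspond as follows.  If \<open>x = 1/a\<close> and \<open>y = 1/b\<close>, then the reciprocal of
  \<open>(a + b)/2\<close> is the harmonic mean of \<open>x\<close> and \<open>y\<close>.  If \<open>x = 1/cosh a\<close> and \<open>y = 1/cosh b\<close>, then
  \<open>x' = tanh a\<close> and \<open>y' = tanh b\<close>, and the half-argument and addition formulas for \<open>cosh\<close> express
  \<open>1/cosh ((a + b)/2)\<close> through \<open>x\<close>, \<open>y\<close>, \<open>x'\<close>, \<open>y'\<close>.
\<close>

section \<open>Strict convexity from a strictly increasing derivative\<close>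

text \<open>
  The midpoint inequality is the mean value theorem on each half of \<open>[a, b]\<close>: the function drops
  more on the left half than on the right half.
\<close>

lemma midpoint_less_of_strict_antimono_slope:
  fixes F h :: "real \<Rightarrow> real"
  assumes deriv: "\<And>x. a \<le> x \<Longrightarrow> x \<le> b \<Longrightarrow> (F has_real_derivative - h x) (at x)"
    and anti: "\<And>x y. a \<le> x \<Longrightarrow> x < y \<Longrightarrow> y \<le> b \<Longrightarrow> h y < h x"
    and "a < b"
  shows "2 * F ((a + b) / 2) < F a + F b"
proof -
  define m where "m = (a + b) / 2"
  have m: "a < m" "m < b" "b - m = m - a"
    using \<open>a < b\<close> by (simp_all add: m_def field_simps)
  obtain s where s: "a < s" "s < m" "F m - F a = (m - a) * - h s"
    using MVT2[of a m F "\<lambda>x. - h x"] m deriv by (metis less_eq_real_def order_trans)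
  obtain t where t: "m < t" "t < b" "F b - F m = (b - m) * - h t"
    using MVT2[of m b F "\<lambda>x. - h x"] m deriv by (metis less_eq_real_def order_trans)
  have "h t < h s"
    using anti[of s t] s t by simp
  then have "(m - a) * h t < (m - a) * h s"
    using m by simp
  then show ?thesis
    using s(3) t(3) m(3) unfolding m_def[symmetric] by simp
qed

lemma strictly_convex_decreasing_on_ray:
  fixes F h :: "real \<Rightarrow> real"
  assumes deriv: "\<And>x. c < x \<Longrightarrow> (F has_real_derivative - h x) (at x)"
    and pos: "\<And>x. c < x \<Longrightarrow> 0 < h x"
    and anti: "\<And>x y. c < x \<Longrightarrow> x < y \<Longrightarrow> h y < h x"
  shows "strict_antimono_on {c<..} F"
    and "convex_on {c<..} F"
    and "c < a \<Longrightarrow> c < b \<Longrightarrow> 2 * F ((a + b) / 2) \<le> F a + F b"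
    and "c < a \<Longrightarrow> c < b \<Longrightarrow> a \<noteq> b \<Longrightarrow> 2 * F ((a + b) / 2) < F a + F b"
proof -
  show "strict_antimono_on {c<..} F"
  proof (rule monotone_onI)
    fix x y assume "x \<in> {c<..}" "y \<in> {c<..}" "x < y"
    then show "F y < F x"
      by (intro DERIV_neg_imp_decreasing[of x y F])
        (auto intro!: exI[of _ "- h _"] deriv pos)
  qed
  show "convex_on {c<..} F"
  proof (rule convex_on_realI)
    show "- h x \<le> - h y" if "x \<in> {c<..}" "y \<in> {c<..}" "x \<le> y" for x y
      using anti[of x y] that by (cases "x = y") auto
  qed (auto intro: deriv)
  have less: "2 * F ((a + b) / 2) < F a + F b" if "c < a" "a < b" for a b
    using that by (intro midpoint_less_of_strict_antimono_slope[of a b F h] deriv anti) auto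
  show strict: "2 * F ((a + b) / 2) < F a + F b" if "c < a" "c < b" "a \<noteq> b"
    using less[of a b] less[of b a] that by (cases "a < b") (auto simp: add.commute)
  show "2 * F ((a + b) / 2) \<le> F a + F b" if "c < a" "c < b"
    using strict that by (cases "a = b") auto
qed

section \<open>The generalized inverse hyperbolic tangent\<close>

lemma powr_less_one_of_unit:
  fixes u p :: real
  assumes "0 \<le> u" "u < 1" "0 < p"
  shows "u powr p < 1"
  using powr_less_mono2[of p u 1] assms by simp

lemma continuous_on_arctanh_p_integrand:
  fixes p b :: real
  assumes "0 < p" "b < 1"
  shows "continuous_on {0..b} (\<lambda>t. inverse (1 - t powr p))"
proof -
  have "\<forall>t\<in>{0..b}. 1 - t powr p \<noteq> 0"
    using powr_less_one_of_unit[of _ p] assms by force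
  then show ?thesis
    using assms by (intro continuous_intros continuous_on_powr') auto
qed

text \<open>The integrand is at least 1, so \<open>arctanh\<^sub>p u\<close> is at least \<open>u\<close>.\<close>

lemma arctanh_p_pos:
  assumes "0 < p" "0 < u" "u < 1"
  shows "0 < arctanh_p p u"
proof -
  have "integral {0..u} (\<lambda>t. 1) \<le> integral {0..u} (\<lambda>t. inverse (1 - t powr p))"
  proof (rule integral_le)
    show "(\<lambda>t. inverse (1 - t powr p)) integrable_on {0..u}"
      using assms by (intro integrable_continuous_real continuous_on_arctanh_p_integrand)
    show "1 \<le> inverse (1 - t powr p)" if "t \<in> {0..u}" for t
      using powr_less_one_of_unit[of t p] that assms by (intro one_le_inverse) auto
  qed (auto intro: integrable_continuous_real)
  then show ?thesis
    using assms by (simp add: arctanh_p_def)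
qed

lemma arctanh_p_has_real_derivative:
  assumes "0 < p" "0 < u" "u < 1"
  shows "(arctanh_p p has_real_derivative 1 / (1 - u powr p)) (at u)"
proof -
  \<comment> \<open>Any right end point strictly between \<open>u\<close> and \<open>1\<close> makes \<open>u\<close> interior and avoids the pole at \<open>1\<close>.\<close>
  define b where "b = (u + 1) / 2"
  have b: "u < b" "b < 1"
    using assms by (auto simp: b_def)
  have "((\<lambda>x. integral {0..x} (\<lambda>t. inverse (1 - t powr p)))
      has_real_derivative inverse (1 - u powr p)) (at u within {0..b})"
    using assms b by (intro integral_has_real_derivative continuous_on_arctanh_p_integrand) auto
  moreover have "at u within {0..b} = at u"
    using assms b by (intro at_within_interior) auto
  moreover have "arctanh_p p = (\<lambda>x. integral {0..x} (\<lambda>t. inverse (1 - t powr p)))"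
    by (auto simp: arctanh_p_def)
  ultimately show ?thesis
    by (simp add: divide_inverse)
qed

section \<open>The substitution by the reciprocal\<close>

lemma arctanh_p_inverse_properties:
  fixes p :: real
  assumes "0 < p"
  defines "g \<equiv> (\<lambda>x::real. arctanh_p p (1 / x))"
  shows "strict_antimono_on {1<..} g"
    and "convex_on {1<..} g"
    and "1 < a \<Longrightarrow> 1 < b \<Longrightarrow> 2 * g ((a + b) / 2) \<le> g a + g b"
    and "1 < a \<Longrightarrow> 1 < b \<Longrightarrow> a \<noteq> b \<Longrightarrow> 2 * g ((a + b) / 2) < g a + g b"
proof -
  define h where "h = (\<lambda>x::real. (1 / x\<^sup>2) / (1 - (1 / x) powr p))"
  have denom: "0 < 1 - (1 / x) powr p" if "1 < x" for x
    using powr_less_one_of_unit[of "1 / x" p] that assms by simp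
  have pos: "0 < h x" if "1 < x" for x
    using denom[OF that] that by (simp add: h_def)
  have deriv: "(g has_real_derivative - h x) (at x)" if "1 < x" for x
  proof -
    have "((\<lambda>x. 1 / x) has_real_derivative - (1 / x\<^sup>2)) (at x)"
      using that by (auto intro!: derivative_eq_intros simp: power2_eq_square)
    from DERIV_chain2[OF arctanh_p_has_real_derivative this, of p]
    show ?thesis
      using assms that by (simp add: g_def h_def mult.commute)
  qed
  have anti: "h y < h x" if "1 < x" "x < y" for x y
  proof -
    have "1 / y\<^sup>2 < 1 / x\<^sup>2"
      using that by (intro divide_strict_left_mono power_strict_mono) auto
    moreover have "(1 / y) powr p \<le> (1 / x) powr p"
      using that assms by (intro powr_mono2) (auto simp: field_simps)
    ultimately show ?thesis
      unfolding h_def using denom[of x] that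
      by (intro frac_less[of "1 / y\<^sup>2"]) auto
  qed
  note props = strictly_convex_decreasing_on_ray[of 1 g h, OF deriv pos anti]
  show "strict_antimono_on {1<..} g"
    by (rule props(1))
  show "convex_on {1<..} g"
    by (rule props(2))
  show "1 < a \<Longrightarrow> 1 < b \<Longrightarrow> 2 * g ((a + b) / 2) \<le> g a + g b"
    "1 < a \<Longrightarrow> 1 < b \<Longrightarrow> a \<noteq> b \<Longrightarrow> 2 * g ((a + b) / 2) < g a + g b"
    by (rule props; assumption)+
qed

section \<open>The substitution by the hyperbolic secant\<close>

text \<open>
  With \<open>s = u\<^sup>p\<close>, \<open>t = v\<^sup>p\<close> and \<open>q = 2/p\<close>, the two sides are the slopes of the chords of \<open>s \<mapsto> s\<^sup>q\<close>
  from \<open>s\<close> to \<open>1\<close> and from \<open>t\<close> to \<open>1\<close>, and \<open>s \<le> t\<close>.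
\<close>

lemma one_minus_square_over_powr_mono:
  fixes p u v :: real
  assumes "0 < p" "p \<le> 2" "0 < u" "u < v" "v < 1"
  shows "(1 - u\<^sup>2) / (1 - u powr p) \<le> (1 - v\<^sup>2) / (1 - v powr p)"
proof -
  have square: "(w powr p) powr (2 / p) = w\<^sup>2" if "0 < w" for w :: real
    using that assms by (simp add: powr_powr)
  have order: "u powr p < v powr p" "v powr p < 1"
    using assms powr_less_one_of_unit[of v p] by (auto intro: powr_less_mono2)
  have "convex_on {0<..} (\<lambda>s::real. s powr (2 / p))"
    using assms by (intro powr_convex) (simp add: field_simps)
  from convex_on_slope_le(2)[OF this, of "u powr p" 1 "v powr p"]
  have "(u\<^sup>2 - 1) / (u powr p - 1) \<le> (v\<^sup>2 - 1) / (v powr p - 1)"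
    using order assms by (simp add: square)
  moreover have "(w\<^sup>2 - 1) / (w powr p - 1) = (1 - w\<^sup>2) / (1 - w powr p)" for w :: real
    by (metis minus_diff_eq minus_divide_divide)
  ultimately show ?thesis
    by simp
qed

lemma one_over_cosh_in_unit:
  fixes x :: real
  assumes "0 < x"
  shows "0 < 1 / cosh x" "1 / cosh x < 1"
  using cosh_real_nonneg_less_iff[of 0 x] assms by auto

lemma one_minus_sech_square: "1 - (1 / cosh x)\<^sup>2 = (sinh x / cosh x)\<^sup>2" for x :: real
  by (simp add: sinh_square_eq power_divide diff_divide_distrib)

lemma arctanh_p_sech_properties:
  fixes p :: real
  assumes "0 < p" "p \<le> 2"
  defines "f \<equiv> (\<lambda>x::real. arctanh_p p (1 / cosh x))"
  shows "strict_antimono_on {0<..} f"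
    and "convex_on {0<..} f"
    and "0 < a \<Longrightarrow> 0 < b \<Longrightarrow> 2 * f ((a + b) / 2) \<le> f a + f b"
    and "0 < a \<Longrightarrow> 0 < b \<Longrightarrow> a \<noteq> b \<Longrightarrow> 2 * f ((a + b) / 2) < f a + f b"
proof -
  define k where "k = (\<lambda>u::real. (1 - u\<^sup>2) / (1 - u powr p))"
  define h where "h = (\<lambda>x::real. (1 / sinh x) * k (1 / cosh x))"
  have k_pos: "0 < k u" if "0 < u" "u < 1" for u
    using powr_less_one_of_unit[of u p] that assms
    by (auto simp: k_def power_less_one_iff intro!: divide_pos_pos)
  have pos: "0 < h x" if "0 < x" for x
    using k_pos one_over_cosh_in_unit[OF that] that by (simp add: h_def)
  have deriv: "(f has_real_derivative - h x) (at x)" if "0 < x" for x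
  proof -
    have "((\<lambda>x. 1 / cosh x) has_real_derivative - (sinh x / (cosh x)\<^sup>2)) (at x)"
      by (auto intro!: derivative_eq_intros simp: power2_eq_square)
    from DERIV_chain2[OF arctanh_p_has_real_derivative this, of p]
    have "(f has_real_derivative
        1 / (1 - (1 / cosh x) powr p) * - (sinh x / (cosh x)\<^sup>2)) (at x)"
      using assms one_over_cosh_in_unit[OF that] by (simp add: f_def)
    moreover have "sinh x / (cosh x)\<^sup>2 = (1 / sinh x) * (1 - (1 / cosh x)\<^sup>2)"
      using that unfolding one_minus_sech_square by (simp add: power2_eq_square)
    ultimately show ?thesis
      by (simp add: h_def k_def mult.commute)
  qed
  have anti: "h y < h x" if "0 < x" "x < y" for x y
  proof -
    have "1 / sinh y < 1 / sinh x"
      using that by (intro divide_strict_left_mono) auto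
    moreover have "k (1 / cosh y) \<le> k (1 / cosh x)"
    proof -
      have "1 / cosh y < 1 / cosh x"
        using that by (intro divide_strict_left_mono) (auto simp: cosh_real_nonneg_less_iff)
      then show ?thesis
        unfolding k_def using assms that one_over_cosh_in_unit[of x] one_over_cosh_in_unit[of y]
        by (intro one_minus_square_over_powr_mono) auto
    qed
    moreover have "0 < k (1 / cosh y)"
      using that one_over_cosh_in_unit[of y] by (intro k_pos) auto
    ultimately show ?thesis
      unfolding h_def using that by (intro mult_less_le_imp_less) auto
  qed
  note props = strictly_convex_decreasing_on_ray[of 0 f h, OF deriv pos anti]
  show "strict_antimono_on {0<..} f"
    by (rule props(1))
  show "convex_on {0<..} f"
    by (rule props(2))
  show "0 < a \<Longrightarrow> 0 < b \<Longrightarrow> 2 * f ((a + b) / 2) \<le> f a + f b"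
    "0 < a \<Longrightarrow> 0 < b \<Longrightarrow> a \<noteq> b \<Longrightarrow> 2 * f ((a + b) / 2) < f a + f b"
    by (rule props; assumption)+
qed

text \<open>
  This is \<open>2 cosh\<^sup>2 ((a + b)/2) = 1 + cosh a cosh b + sinh a sinh b\<close> with \<open>sinh\<close> eliminated in
  favour of \<open>x' = tanh a\<close> and \<open>y' = tanh b\<close>.
\<close>

lemma sech_midpoint:
  fixes a b :: real
  assumes "0 \<le> a" "0 \<le> b"
  defines "x \<equiv> 1 / cosh a" and "y \<equiv> 1 / cosh b"
  shows "1 / cosh ((a + b) / 2) =
    sqrt (2 * x * y / (1 + x * y + sqrt (1 - x\<^sup>2) * sqrt (1 - y\<^sup>2)))"
proof -
  have tanh: "sqrt (1 - (1 / cosh c)\<^sup>2) = sinh c / cosh c" if "0 \<le> c" for c :: real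
    using that unfolding one_minus_sech_square by simp
  have half: "2 * (cosh ((a + b) / 2))\<^sup>2 = 1 + (cosh a * cosh b + sinh a * sinh b)"
    using cosh_double_cosh[of "(a + b) / 2"] by (simp flip: cosh_add add: add_divide_distrib)
  have eq: "(1 / cosh ((a + b) / 2))\<^sup>2 = 2 / (1 + (cosh a * cosh b + sinh a * sinh b))"
    unfolding half[symmetric] by (simp add: power_divide)
  have "2 * x * y / (1 + x * y + sqrt (1 - x\<^sup>2) * sqrt (1 - y\<^sup>2)) =
      (2 / (cosh a * cosh b)) / ((1 + (cosh a * cosh b + sinh a * sinh b)) / (cosh a * cosh b))"
    unfolding x_def y_def tanh[OF assms(1)] tanh[OF assms(2)] by (simp add: field_simps)
  also have "\<dots> = (1 / cosh ((a + b) / 2))\<^sup>2"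
    unfolding eq by simp
  finally show ?thesis
    by simp
qed

section \<open>The two convexity statements and their inequalities\<close>

theorem theorem4:
  shows
    "((\<forall>p\<in>{1..2::real}.
         (let f = (\<lambda>x::real. arctanh_p p (1 / cosh x)) in
            f \<in> {0<..} \<rightarrow> {0<..} \<and> strict_antimono_on {0<..} f \<and> convex_on {0<..} f)) \<and>
      (\<forall>x\<in>{0<..<1::real}. \<forall>y\<in>{0<..<1::real}. \<forall>p\<in>{1..2::real}.
         (let x' = sqrt (1 - x\<^sup>2); y' = sqrt (1 - y\<^sup>2);
              l = arctanh_p p x + arctanh_p p y;
              r = 2 * arctanh_p p (sqrt (2 * x * y / (1 + x * y + x' * y')))
          in l \<ge> r \<and> (x \<noteq> y \<longrightarrow> l > r)))) \<and>
     ((\<forall>p\<in>{(0::real)<..}.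
         (let g = (\<lambda>x::real. arctanh_p p (1 / x)) in
            g \<in> {1<..} \<rightarrow> {0<..} \<and> strict_antimono_on {1<..} g \<and> convex_on {1<..} g)) \<and>
      (\<forall>x\<in>{0<..<1::real}. \<forall>y\<in>{0<..<1::real}. \<forall>p\<in>{(0::real)<..}.
         (let l = arctanh_p p x + arctanh_p p y;
              r = 2 * arctanh_p p (2 * x * y / (x + y))
          in l \<ge> r \<and> (x \<noteq> y \<longrightarrow> l > r))))"
proof (intro conjI ballI)
  fix p :: real
  assume p: "p \<in> {1..2}"
  then have "0 < p" "p \<le> 2"
    by auto
  then show "let f = (\<lambda>x::real. arctanh_p p (1 / cosh x)) in
      f \<in> {0<..} \<rightarrow> {0<..} \<and> strict_antimono_on {0<..} f \<and> convex_on {0<..} f"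
    unfolding Let_def
    by (intro conjI Pi_I arctanh_p_sech_properties(1,2))
      (simp_all only: greaterThan_iff arctanh_p_pos one_over_cosh_in_unit)
next
  fix x y p :: real
  assume xy: "x \<in> {0<..<1}" "y \<in> {0<..<1}" and p: "p \<in> {1..2}"
  define a where "a = arcosh (1 / x)"
  define b where "b = arcosh (1 / y)"
  have ab: "0 < a" "0 < b" and x: "x = 1 / cosh a" and y: "y = 1 / cosh b"
    using xy by (auto simp: a_def b_def)
  have "1 / cosh ((a + b) / 2) =
      sqrt (2 * x * y / (1 + x * y + sqrt (1 - x\<^sup>2) * sqrt (1 - y\<^sup>2)))"
    using sech_midpoint[of a b] ab by (simp add: x y)
  moreover have "x \<noteq> y \<longrightarrow> a \<noteq> b"
    by (auto simp: x y)
  ultimately show "let x' = sqrt (1 - x\<^sup>2); y' = sqrt (1 - y\<^sup>2);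
        l = arctanh_p p x + arctanh_p p y;
        r = 2 * arctanh_p p (sqrt (2 * x * y / (1 + x * y + x' * y')))
      in l \<ge> r \<and> (x \<noteq> y \<longrightarrow> l > r)"
    using arctanh_p_sech_properties(3,4)[of p a b] ab p unfolding Let_def x[symmetric] y[symmetric]
    by simp
next
  fix p :: real
  assume "p \<in> {0<..}"
  then show "let g = (\<lambda>x::real. arctanh_p p (1 / x)) in
      g \<in> {1<..} \<rightarrow> {0<..} \<and> strict_antimono_on {1<..} g \<and> convex_on {1<..} g"
    unfolding Let_def
    by (intro conjI Pi_I arctanh_p_inverse_properties(1,2)) (auto intro: arctanh_p_pos)
next
  fix x y p :: real
  assume xy: "x \<in> {0<..<1}" "y \<in> {0<..<1}" and p: "p \<in> {0<..}"
  have "1 / ((1 / x + 1 / y) / 2) = 2 * x * y / (x + y)"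
    using xy by (simp add: field_simps)
  then show "let l = arctanh_p p x + arctanh_p p y;
        r = 2 * arctanh_p p (2 * x * y / (x + y))
      in l \<ge> r \<and> (x \<noteq> y \<longrightarrow> l > r)"
    using arctanh_p_inverse_properties(3,4)[of p "1 / x" "1 / y"] xy p unfolding Let_def by simp
qed

end
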